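(* Let $m\ge2$, let $G$ be a path-connected topological group and let $X$ be an ANR. Then the homotopy classes of maps $X^m\to G$ that are null-homotopic on the diagonal $\Delta X\subset X^m$ form a nilpotent group (under pointwise multiplication) of nilpotency class at most $\mathsf{TC}_m(X)$.
   Context: $\Delta X=\{(x,\dots,x)\mid x\in X\}\subset X^m$. $\mathsf{TC}_m(X)$ is the $m$-th sequential topological complexity of $X$ (normalized): with fixed times $0=t_1<\dots<t_m=1$, it is the least $n\ge0$ such that $X^m$ is covered by $n+1$ open sets over each of which the fibration $\pi^X_m\colon X^I\to X^m$, $\gamma\mapsto(\gamma(t_1),\dots,\gamma(t_m))$, has a continuous partial section. A group $H$ is nilpotent of class $c$ if $c$ is the smallest integer for which there is a central series $H=\Gamma_1\trianglerighteq\Gamma_2\trianglerighteq\dots\trianglerighteq\Gamma_{c+1}=\{1\}$, i.e. $hkh^{-1}k^{-1}\in\Gamma_{i+1}$ for all $h\in H$, $k\in\Gamma_i$. *)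

theory Defs
  imports "HOL-Analysis.Analysis" "HOL-Algebra.Coset" "HOL-Library.Extended_Nat"
begin

section \<open>Absolute neighbourhood retracts\<close>

text \<open>
  The library predicate \<open>ANR\<close> is about subsets of a single type, tested inside (essentially) that
  type, and is meant for subsets of Euclidean spaces. Here \<open>X\<close> is an arbitrary metrizable space,
  and it is an ANR if it is a neighbourhood retract in every metrizable space that contains it as
  a closed subspace.

  Test spaces have to live in a fixed type; \<^typ>\<open>'a \<Rightarrow> real\<close> is large enough to give the absolute
  notion. Up to homeomorphism, a metrizable space on points of type \<^typ>\<open>'a\<close> is closed in a convex
  subset of the normed space of bounded functions \<^typ>\<open>'a \<Rightarrow> real\<close> (Kuratowski, Wojdyslawski), and
  a neighbourhood retract of a convex subset of a normed space is an absolute neighbourhood extensor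
  for all metrizable spaces (Dugundji), hence a neighbourhood retract of every metrizable space in
  which it is closed.
\<close>

definition ANR_space :: "'a topology \<Rightarrow> bool" where
  "ANR_space X \<longleftrightarrow>
     metrizable_space X \<and>
     (\<forall>(Z :: ('a \<Rightarrow> real) topology) A.
        metrizable_space Z \<and> closedin Z A \<and> X homeomorphic_space (subtopology Z A)
        \<longrightarrow> (\<exists>W. openin Z W \<and> A \<subseteq> W \<and> A retract_of_space (subtopology Z W)))"


section \<open>Topological groups\<close>

text \<open>
  The type class \<open>topological_group_add\<close> is additive and ties the group to a whole type. The
  multiplicative, carrier-based version matches the groups of \<open>HOL-Algebra\<close>. No separation axiom
  is required.
\<close>

definition topological_group :: "('g, 'r) monoid_scheme \<Rightarrow> 'g topology \<Rightarrow> bool" where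
  "topological_group G T \<longleftrightarrow>
     group G \<and> topspace T = carrier G \<and>
     continuous_map (prod_topology T T) T (\<lambda>(x, y). x \<otimes>\<^bsub>G\<^esub> y) \<and>
     continuous_map T T (\<lambda>x. inv\<^bsub>G\<^esub> x)"


section \<open>Sequential topological complexity\<close>

definition power_topology :: "nat \<Rightarrow> 'a topology \<Rightarrow> (nat \<Rightarrow> 'a) topology" where
  "power_topology m X = product_topology (\<lambda>_. X) {..<m}"

definition diagonal :: "nat \<Rightarrow> 'a topology \<Rightarrow> (nat \<Rightarrow> 'a) set" where
  "diagonal m X = (\<lambda>x. \<lambda>i\<in>{..<m}. x) ` topspace X"

text \<open>Points of the mapping space are extensional, so that each map has a unique representative.\<close>

definition mapping_space :: "'a topology \<Rightarrow> 'b topology \<Rightarrow> ('a \<Rightarrow> 'b) set" where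
  "mapping_space Y X = {f \<in> extensional (topspace Y). continuous_map Y X f}"

definition compact_open_topology :: "'a topology \<Rightarrow> 'b topology \<Rightarrow> ('a \<Rightarrow> 'b) topology" where
  "compact_open_topology Y X =
     topology_generated_by
       {{f \<in> mapping_space Y X. f ` K \<subseteq> V} | K V. compactin Y K \<and> openin X V}"

lemma topspace_compact_open_topology [simp]:
  "topspace (compact_open_topology Y X) = mapping_space Y X"
proof -
  have "mapping_space Y X \<in> {{f \<in> mapping_space Y X. f ` K \<subseteq> V} | K V. compactin Y K \<and> openin X V}"
    by (rule CollectI, rule exI[of _ "{}"], rule exI[of _ "{}"]) simp
  then show ?thesis
    unfolding compact_open_topology_def topology_generated_by_topspace by blast
qed

definition path_topology :: "'a topology \<Rightarrow> (real \<Rightarrow> 'a) topology" where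
  "path_topology X = compact_open_topology (top_of_set {0..1}) X"

definition path_eval :: "nat \<Rightarrow> (nat \<Rightarrow> real) \<Rightarrow> (real \<Rightarrow> 'a) \<Rightarrow> (nat \<Rightarrow> 'a)" where
  "path_eval m t \<gamma> = (\<lambda>i\<in>{..<m}. \<gamma> (t i))"

text \<open>The times \<open>t\<^sub>1, \<dots>, t\<^sub>m\<close> are \<open>t 0, \<dots>, t (m - 1)\<close>.\<close>

definition evaluation_times :: "nat \<Rightarrow> (nat \<Rightarrow> real) \<Rightarrow> bool" where
  "evaluation_times m t \<longleftrightarrow> t 0 = 0 \<and> t (m - 1) = 1 \<and> strict_mono_on {..<m} t"

definition has_section_over :: "nat \<Rightarrow> (nat \<Rightarrow> real) \<Rightarrow> 'a topology \<Rightarrow> (nat \<Rightarrow> 'a) set \<Rightarrow> bool" where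
  "has_section_over m t X U \<longleftrightarrow>
     (\<exists>s. continuous_map (subtopology (power_topology m X) U) (path_topology X) s \<and>
          (\<forall>x\<in>U. path_eval m t (s x) = x))"

text \<open>The value is \<open>\<infinity>\<close> if there is no finite cover as required.\<close>

definition sequential_TC :: "nat \<Rightarrow> (nat \<Rightarrow> real) \<Rightarrow> 'a topology \<Rightarrow> enat" where
  "sequential_TC m t X =
     Inf {enat n | n. \<exists>U :: nat \<Rightarrow> (nat \<Rightarrow> 'a) set.
            (\<forall>i\<le>n. openin (power_topology m X) (U i) \<and> has_section_over m t X (U i)) \<and>
            (\<Union>i\<le>n. U i) = topspace (power_topology m X)}"


section \<open>Nilpotency class\<close>

definition central_series :: "('g, 'r) monoid_scheme \<Rightarrow> nat \<Rightarrow> (nat \<Rightarrow> 'g set) \<Rightarrow> bool" where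
  "central_series H c \<Gamma> \<longleftrightarrow>
     \<Gamma> 1 = carrier H \<and> \<Gamma> (c + 1) = {\<one>\<^bsub>H\<^esub>} \<and>
     (\<forall>i\<in>{1..c}. \<Gamma> (i + 1) \<lhd> H\<lparr>carrier := \<Gamma> i\<rparr> \<and>
        (\<forall>h\<in>carrier H. \<forall>k\<in>\<Gamma> i. h \<otimes>\<^bsub>H\<^esub> k \<otimes>\<^bsub>H\<^esub> inv\<^bsub>H\<^esub> h \<otimes>\<^bsub>H\<^esub> inv\<^bsub>H\<^esub> k \<in> \<Gamma> (i + 1)))"

definition nilpotent_group :: "('g, 'r) monoid_scheme \<Rightarrow> bool" where
  "nilpotent_group H \<longleftrightarrow> group H \<and> (\<exists>c \<Gamma>. central_series H c \<Gamma>)"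

text \<open>The value is \<open>\<infinity>\<close> if \<open>H\<close> is not nilpotent.\<close>

definition nilpotency_class :: "('g, 'r) monoid_scheme \<Rightarrow> enat" where
  "nilpotency_class H = Inf {enat c | c. \<exists>\<Gamma>. central_series H c \<Gamma>}"


section \<open>Homotopy classes of maps into a topological group\<close>

text \<open>
  Homotopies are free. The relation \<^const>\<open>homotopic_with\<close> does not constrain the values of
  functions outside the domain space, so functions agreeing on it are in the same class.
\<close>

definition homotopy_rel :: "'a topology \<Rightarrow> 'b topology \<Rightarrow> (('a \<Rightarrow> 'b) \<times> ('a \<Rightarrow> 'b)) set" where
  "homotopy_rel Y T = {(f, g). homotopic_with (\<lambda>_. True) Y T f g}"

definition null_homotopic_on :: "'a topology \<Rightarrow> 'b topology \<Rightarrow> 'a set \<Rightarrow> ('a \<Rightarrow> 'b) \<Rightarrow> bool" where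
  "null_homotopic_on Y T S f \<longleftrightarrow>
     (\<exists>c. homotopic_with (\<lambda>_. True) (subtopology Y S) T f (\<lambda>_. c))"

definition null_on_classes_group ::
    "'a topology \<Rightarrow> 'a set \<Rightarrow> ('g, 'r) monoid_scheme \<Rightarrow> 'g topology \<Rightarrow> ('a \<Rightarrow> 'g) set monoid" where
  "null_on_classes_group Y S G T =
     \<lparr>carrier = {f. continuous_map Y T f \<and> null_homotopic_on Y T S f} // homotopy_rel Y T,
      mult = (\<lambda>A B. \<Union>f\<in>A. \<Union>g\<in>B. homotopy_rel Y T `` {\<lambda>x. f x \<otimes>\<^bsub>G\<^esub> g x}),
      one = homotopy_rel Y T `` {\<lambda>_. \<one>\<^bsub>G\<^esub>}\<rparr>"

end

theory Submission
  imports Defs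
begin

text \<open>
  Let \<open>U\<^sub>0, \<dots>, U\<^sub>n\<close> be an open cover of \<open>X\<^sup>m\<close> with a partial section \<open>s\<close> of the path fibration over
  each member. Shrinking the path \<open>s x\<close> towards its initial point moves \<open>x\<close> inside \<open>X\<^sup>m\<close> to a point
  of the diagonal (\<open>section_deforms_into_diagonal\<close>), so a map to \<open>G\<close> that is null-homotopic on the
  diagonal is null-homotopic on every \<open>U\<^sub>i\<close>. Path-connectedness of \<open>G\<close> allows the constant to be the
  unit.

  It remains to see that a group of homotopy classes of maps \<open>Y \<rightarrow> G\<close> is nilpotent of class at
  most \<open>n\<close> if all the maps are null-homotopic on each of \<open>n + 1\<close> open sets covering \<open>Y\<close>. This is the
  argument of G. W. Whitehead for the Lusternik-Schnirelmann category. A commutator of two maps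
  is \<open>1\<close> wherever one of them is \<open>1\<close> (\<open>commutator_unit_on_classes\<close>). As \<open>Y = X\<^sup>m\<close> is metrizable,
  hence normal, the cover shrinks to closed sets \<open>A\<^sub>i \<subseteq> U\<^sub>i\<close> that still cover, and Urysohn's lemma
  turns a null-homotopy on \<open>U\<^sub>i\<close> into a homotopy on all of \<open>Y\<close> to a map that is \<open>1\<close> on \<open>A\<^sub>i\<close>
  (\<open>homotopic_to_unit_on_closed\<close>). Let \<open>\<Gamma>\<^sub>i\<close> consist of the classes that contain a map equal to \<open>1\<close> on
  \<open>A\<^sub>0 \<union> \<dots> \<union> A\<^bsub>i-1\<^esub>\<close>. Then \<open>\<Gamma>\<^sub>1\<close> is the whole group, since every class contains a map equal to \<open>1\<close>
  on \<open>A\<^sub>0\<close>, the subgroup \<open>\<Gamma>\<^bsub>n+1\<^esub>\<close> is trivial, and a commutator of a class in \<open>\<Gamma>\<^sub>i\<close> with any class,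
  represented by a map equal to \<open>1\<close> on \<open>A\<^sub>i\<close>, lies in \<open>\<Gamma>\<^bsub>i+1\<^esub>\<close>. Starting at \<open>\<Gamma>\<^sub>1\<close> rather than at the
  classes without any condition is what gives length \<open>n\<close> for \<open>n + 1\<close> sets.
\<close>

section \<open>Maps into a topological group up to homotopy\<close>

locale topological_group_space = group G for G :: "('g, 'r) monoid_scheme" (structure) +
  fixes T :: "'g topology"
  assumes topspace_eq: "topspace T = carrier G"
    and continuous_mult: "continuous_map (prod_topology T T) T (\<lambda>(x, y). x \<otimes> y)"
    and continuous_inv: "continuous_map T T (\<lambda>x. inv x)"

lemma topological_group_space_iff: "topological_group_space G T \<longleftrightarrow> topological_group G T"
  unfolding topological_group_space_def topological_group_space_axioms_def topological_group_def
  by blast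

context topological_group_space
begin

declare topspace_eq [simp]

abbreviation homotopic :: "'y topology \<Rightarrow> ('y \<Rightarrow> 'g) \<Rightarrow> ('y \<Rightarrow> 'g) \<Rightarrow> bool" where
  "homotopic Y f g \<equiv> homotopic_with (\<lambda>_. True) Y T f g"

abbreviation homotopy_class :: "'y topology \<Rightarrow> ('y \<Rightarrow> 'g) \<Rightarrow> ('y \<Rightarrow> 'g) set" where
  "homotopy_class Y f \<equiv> homotopy_rel Y T `` {f}"

abbreviation classes_group :: "'y topology \<Rightarrow> 'y set \<Rightarrow> ('y \<Rightarrow> 'g) set monoid" where
  "classes_group Y S \<equiv> null_on_classes_group Y S G T"

definition maps_null_on :: "'y topology \<Rightarrow> 'y set \<Rightarrow> ('y \<Rightarrow> 'g) set" where
  "maps_null_on Y S = {f. continuous_map Y T f \<and> null_homotopic_on Y T S f}"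

lemma continuous_map_mult:
  assumes "continuous_map Z T f" "continuous_map Z T g"
  shows "continuous_map Z T (\<lambda>z. f z \<otimes> g z)"
proof -
  have "continuous_map Z (prod_topology T T) (\<lambda>z. (f z, g z))"
    using assms by (rule continuous_map_pairedI)
  from continuous_map_compose[OF this continuous_mult] show ?thesis
    by (simp add: o_def)
qed

lemma continuous_map_inv:
  assumes "continuous_map Z T f"
  shows "continuous_map Z T (\<lambda>z. inv (f z))"
  using continuous_map_compose[OF assms continuous_inv] by (simp add: o_def)

lemma continuous_map_one: "continuous_map Z T (\<lambda>_. \<one>)"
  by simp

lemma continuous_map_carrier:
  "continuous_map Z T f \<Longrightarrow> z \<in> topspace Z \<Longrightarrow> f z \<in> carrier G"
  using topspace_eq continuous_map_funspace by fastforce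

lemma homotopic_mult:
  assumes "homotopic Y f f'" "homotopic Y g g'"
  shows "homotopic Y (\<lambda>y. f y \<otimes> g y) (\<lambda>y. f' y \<otimes> g' y)"
proof -
  obtain h k where h: "continuous_map (prod_topology (top_of_set {0..1::real}) Y) T h"
      "\<And>y. h (0, y) = f y" "\<And>y. h (1, y) = f' y"
    and k: "continuous_map (prod_topology (top_of_set {0..1::real}) Y) T k"
      "\<And>y. k (0, y) = g y" "\<And>y. k (1, y) = g' y"
    using assms unfolding homotopic_with_def by metis
  show ?thesis
    unfolding homotopic_with_def
    by (rule exI[of _ "\<lambda>z. h z \<otimes> k z"]) (simp add: h k continuous_map_mult)
qed

lemma homotopic_inv:
  assumes "homotopic Y f f'"
  shows "homotopic Y (\<lambda>y. inv (f y)) (\<lambda>y. inv (f' y))"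
  using homotopic_with_compose_continuous_map_left[OF assms continuous_inv, of "\<lambda>_. True"]
  by (simp add: o_def)

lemma homotopy_class_self: "continuous_map Y T f \<Longrightarrow> f \<in> homotopy_class Y f"
  by (simp add: homotopy_rel_def)

lemma homotopy_class_eq_iff:
  assumes "continuous_map Y T g"
  shows "homotopy_class Y f = homotopy_class Y g \<longleftrightarrow> homotopic Y f g"
proof
  assume eq: "homotopy_class Y f = homotopy_class Y g"
  have "g \<in> homotopy_class Y g"
    using assms by (rule homotopy_class_self)
  then have "g \<in> homotopy_class Y f"
    by (simp only: eq)
  then show "homotopic Y f g"
    by (simp add: homotopy_rel_def)
next
  assume fg: "homotopic Y f g"
  have "homotopic Y f k \<longleftrightarrow> homotopic Y g k" for k
    using homotopic_with_trans[OF fg] homotopic_with_trans[OF homotopic_with_symD[OF fg]] by blast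
  then show "homotopy_class Y f = homotopy_class Y g"
    by (simp add: homotopy_rel_def Image_singleton)
qed

lemma homotopy_class_cong:
  assumes "continuous_map Y T f" "\<And>y. y \<in> topspace Y \<Longrightarrow> f y = g y"
  shows "homotopy_class Y f = homotopy_class Y g"
proof -
  have "homotopic Y f g"
    using assms by (intro homotopic_with_equal) auto
  moreover from this have "continuous_map Y T g"
    using homotopic_with_imp_continuous_maps by blast
  ultimately show ?thesis
    by (simp add: homotopy_class_eq_iff)
qed

lemma mult_classes_group:
  assumes "continuous_map Y T f" "continuous_map Y T g"
  shows "homotopy_class Y f \<otimes>\<^bsub>classes_group Y S\<^esub> homotopy_class Y g
    = homotopy_class Y (\<lambda>y. f y \<otimes> g y)"
proof -
  have "homotopy_class Y (\<lambda>y. f' y \<otimes> g' y) = homotopy_class Y (\<lambda>y. f y \<otimes> g y)"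
    if "f' \<in> homotopy_class Y f" "g' \<in> homotopy_class Y g" for f' g'
  proof -
    have "homotopic Y f' f" "homotopic Y g' g"
      using that by (simp_all add: homotopy_rel_def homotopic_with_sym[of _ Y T f' f]
          homotopic_with_sym[of _ Y T g' g])
    then show ?thesis
      by (simp add: homotopy_class_eq_iff continuous_map_mult assms homotopic_mult)
  qed
  moreover have "homotopy_class Y f \<noteq> {}" "homotopy_class Y g \<noteq> {}"
    using homotopy_class_self[OF assms(1)] homotopy_class_self[OF assms(2)] by blast+
  ultimately have "(\<Union>f'\<in>homotopy_class Y f. \<Union>g'\<in>homotopy_class Y g.
      homotopy_class Y (\<lambda>y. f' y \<otimes> g' y)) = homotopy_class Y (\<lambda>y. f y \<otimes> g y)"
    by (intro SUP_eq_const)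
  then show ?thesis
    by (simp add: null_on_classes_group_def)
qed

end

locale path_connected_topological_group = topological_group_space G T
  for G :: "('g, 'r) monoid_scheme" (structure) and T :: "'g topology" +
  assumes path_connected: "path_connected_space T"
begin

text \<open>
  Any two constants in a path-connected group are homotopic, so the constant may be taken to be
  the unit. With this normal form, products and inverses of null-homotopic maps are null-homotopic.
\<close>

lemma null_homotopic_on_iff:
  "null_homotopic_on Y T S f \<longleftrightarrow> homotopic (subtopology Y S) f (\<lambda>_. \<one>)"
proof
  assume "null_homotopic_on Y T S f"
  then obtain c where c: "homotopic (subtopology Y S) f (\<lambda>_. c)"
    by (auto simp: null_homotopic_on_def)
  have "homotopic (subtopology Y S) (\<lambda>_. c) (\<lambda>_. \<one>)"
  proof (cases "subtopology Y S = trivial_topology")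
    case False
    moreover have "continuous_map (subtopology Y S) T (\<lambda>_. c)"
      using c homotopic_with_imp_continuous_maps by blast
    ultimately have "c \<in> topspace T"
      by (simp only: continuous_map_const simp_thms)
    then have "path_component_of T c \<one>"
      using path_connected by (simp add: path_connected_space_iff_path_component topspace_eq)
    then show ?thesis
      by (simp add: homotopic_constant_maps)
  qed (simp add: homotopic_constant_maps)
  with c show "homotopic (subtopology Y S) f (\<lambda>_. \<one>)"
    by (rule homotopic_with_trans)
qed (auto simp: null_homotopic_on_def)

lemma maps_null_on_mult:
  assumes "f \<in> maps_null_on Y S" "g \<in> maps_null_on Y S"
  shows "(\<lambda>y. f y \<otimes> g y) \<in> maps_null_on Y S"
  using assms homotopic_mult[of "subtopology Y S" f "\<lambda>_. \<one>" g "\<lambda>_. \<one>"]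
  by (simp add: maps_null_on_def null_homotopic_on_iff continuous_map_mult)

lemma maps_null_on_inv:
  assumes "f \<in> maps_null_on Y S"
  shows "(\<lambda>y. inv (f y)) \<in> maps_null_on Y S"
  using assms homotopic_inv[of "subtopology Y S" f "\<lambda>_. \<one>"]
  by (simp add: maps_null_on_def null_homotopic_on_iff continuous_map_inv)

lemma maps_null_on_one: "(\<lambda>_. \<one>) \<in> maps_null_on Y S"
  by (simp add: maps_null_on_def null_homotopic_on_iff continuous_map_one)

lemma maps_null_on_homotopic:
  assumes "f \<in> maps_null_on Y S" "homotopic Y f g"
  shows "g \<in> maps_null_on Y S"
proof -
  have "homotopic (subtopology Y S) g f"
    using assms(2) by (rule homotopic_from_subtopology[OF homotopic_with_symD])
  moreover have "homotopic (subtopology Y S) f (\<lambda>_. \<one>)"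
    using assms(1) by (simp add: maps_null_on_def null_homotopic_on_iff)
  ultimately have "homotopic (subtopology Y S) g (\<lambda>_. \<one>)"
    by (rule homotopic_with_trans)
  then show ?thesis
    using homotopic_with_imp_continuous_maps[OF assms(2)]
    by (simp add: maps_null_on_def null_homotopic_on_iff)
qed

lemma maps_null_on_continuous: "f \<in> maps_null_on Y S \<Longrightarrow> continuous_map Y T f"
  by (simp add: maps_null_on_def)

lemma carrier_classes_group:
  "carrier (classes_group Y S) = homotopy_class Y ` maps_null_on Y S"
  by (auto simp: null_on_classes_group_def maps_null_on_def quotient_def)

lemma one_classes_group: "\<one>\<^bsub>classes_group Y S\<^esub> = homotopy_class Y (\<lambda>_. \<one>)"
  by (simp add: null_on_classes_group_def)

lemma group_classes_group: "group (classes_group Y S)"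
proof (rule groupI)
  let ?H = "classes_group Y S"
  note cont = continuous_map_mult continuous_map_one continuous_map_inv
  show "\<one>\<^bsub>?H\<^esub> \<in> carrier ?H"
    by (simp add: carrier_classes_group one_classes_group maps_null_on_one)
  fix a assume "a \<in> carrier ?H"
  then obtain f where f: "f \<in> maps_null_on Y S" and a: "a = homotopy_class Y f"
    by (auto simp: carrier_classes_group)
  note cf = maps_null_on_continuous[OF f]
  show "\<one>\<^bsub>?H\<^esub> \<otimes>\<^bsub>?H\<^esub> a = a"
    unfolding a one_classes_group mult_classes_group[OF continuous_map_one cf]
    by (rule homotopy_class_cong)
      (use continuous_map_carrier[OF cf] in \<open>auto intro: cont cf\<close>)
  show "\<exists>b\<in>carrier ?H. b \<otimes>\<^bsub>?H\<^esub> a = \<one>\<^bsub>?H\<^esub>"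
  proof
    show "homotopy_class Y (\<lambda>y. inv (f y)) \<in> carrier ?H"
      using f by (simp add: carrier_classes_group maps_null_on_inv)
    show "homotopy_class Y (\<lambda>y. inv (f y)) \<otimes>\<^bsub>?H\<^esub> a = \<one>\<^bsub>?H\<^esub>"
      unfolding a one_classes_group mult_classes_group[OF continuous_map_inv[OF cf] cf]
      by (rule homotopy_class_cong[OF continuous_map_mult[OF continuous_map_inv[OF cf] cf]])
        (use continuous_map_carrier[OF cf] in auto)
  qed
  fix b assume "b \<in> carrier ?H"
  then obtain g where g: "g \<in> maps_null_on Y S" and b: "b = homotopy_class Y g"
    by (auto simp: carrier_classes_group)
  note cg = maps_null_on_continuous[OF g]
  show "a \<otimes>\<^bsub>?H\<^esub> b \<in> carrier ?H"
    unfolding a b mult_classes_group[OF cf cg] using f g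
    by (simp add: carrier_classes_group maps_null_on_mult)
  fix c assume "c \<in> carrier ?H"
  then obtain k where k: "k \<in> maps_null_on Y S" and c: "c = homotopy_class Y k"
    by (auto simp: carrier_classes_group)
  note ck = maps_null_on_continuous[OF k]
  have "homotopy_class Y (\<lambda>y. f y \<otimes> g y \<otimes> k y) = homotopy_class Y (\<lambda>y. f y \<otimes> (g y \<otimes> k y))"
    by (rule homotopy_class_cong[OF continuous_map_mult[OF continuous_map_mult[OF cf cg] ck]])
      (rule m_assoc; rule continuous_map_carrier, (rule cf cg ck | assumption)+)
  then show "a \<otimes>\<^bsub>?H\<^esub> b \<otimes>\<^bsub>?H\<^esub> c = a \<otimes>\<^bsub>?H\<^esub> (b \<otimes>\<^bsub>?H\<^esub> c)"
    by (simp add: a b c mult_classes_group cont cf cg ck)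
qed

lemma inv_classes_group:
  assumes f: "f \<in> maps_null_on Y S"
  shows "inv\<^bsub>classes_group Y S\<^esub> (homotopy_class Y f) = homotopy_class Y (\<lambda>y. inv (f y))"
proof -
  interpret H: group "classes_group Y S"
    by (rule group_classes_group)
  note cf = maps_null_on_continuous[OF f]
  have "homotopy_class Y (\<lambda>y. inv (f y)) \<otimes>\<^bsub>classes_group Y S\<^esub> homotopy_class Y f
      = \<one>\<^bsub>classes_group Y S\<^esub>"
    unfolding one_classes_group mult_classes_group[OF continuous_map_inv[OF cf] cf]
    by (rule homotopy_class_cong[OF continuous_map_mult[OF continuous_map_inv[OF cf] cf]])
      (use continuous_map_carrier[OF cf] in auto)
  then show ?thesis
    using f by (intro H.inv_equality) (simp_all add: carrier_classes_group maps_null_on_inv)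
qed


section \<open>Classes represented by maps trivial on a given set\<close>

definition unit_on_classes :: "'y topology \<Rightarrow> 'y set \<Rightarrow> 'y set \<Rightarrow> ('y \<Rightarrow> 'g) set set" where
  "unit_on_classes Y S A = homotopy_class Y ` {f \<in> maps_null_on Y S. \<forall>y\<in>topspace Y \<inter> A. f y = \<one>}"

lemma unit_on_classesI:
  assumes "f \<in> maps_null_on Y S" "\<And>y. y \<in> topspace Y \<Longrightarrow> y \<in> A \<Longrightarrow> f y = \<one>"
  shows "homotopy_class Y f \<in> unit_on_classes Y S A"
  using assms unfolding unit_on_classes_def by (intro imageI) simp

lemma unit_on_classesE:
  assumes "a \<in> unit_on_classes Y S A"
  obtains f where "f \<in> maps_null_on Y S" "a = homotopy_class Y f" "continuous_map Y T f"
    "\<And>y. y \<in> topspace Y \<Longrightarrow> f y \<in> carrier G"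
    "\<And>y. y \<in> topspace Y \<Longrightarrow> y \<in> A \<Longrightarrow> f y = \<one>"
proof -
  obtain f where f: "f \<in> maps_null_on Y S" "a = homotopy_class Y f"
      "\<forall>y\<in>topspace Y \<inter> A. f y = \<one>"
    using assms unfolding unit_on_classes_def by (elim imageE CollectE conjE)
  show thesis
    using that[OF f(1,2) maps_null_on_continuous[OF f(1)]
        continuous_map_carrier[OF maps_null_on_continuous[OF f(1)]]] f(3) by simp
qed

lemma unit_on_classes_mono:
  assumes "A \<subseteq> B"
  shows "unit_on_classes Y S B \<subseteq> unit_on_classes Y S A"
proof
  fix a assume "a \<in> unit_on_classes Y S B"
  then obtain f where f: "f \<in> maps_null_on Y S" "a = homotopy_class Y f"
    "\<And>y. y \<in> topspace Y \<Longrightarrow> y \<in> B \<Longrightarrow> f y = \<one>"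
    by (rule unit_on_classesE) blast
  show "a \<in> unit_on_classes Y S A"
    unfolding f(2) using f(1) by (rule unit_on_classesI) (use f(3) assms in blast)
qed

lemma unit_on_classes_topspace:
  "unit_on_classes Y S (topspace Y) = {\<one>\<^bsub>classes_group Y S\<^esub>}"
proof (intro equalityI subsetI)
  fix a assume "a \<in> unit_on_classes Y S (topspace Y)"
  then obtain f where f: "a = homotopy_class Y f" "continuous_map Y T f"
    "\<And>y. y \<in> topspace Y \<Longrightarrow> y \<in> topspace Y \<Longrightarrow> f y = \<one>"
    by (rule unit_on_classesE) blast
  show "a \<in> {\<one>\<^bsub>classes_group Y S\<^esub>}"
    unfolding f(1) one_classes_group singleton_iff using f(2,3) by (rule homotopy_class_cong)
next
  fix a assume "a \<in> {\<one>\<^bsub>classes_group Y S\<^esub>}"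
  then have "a = homotopy_class Y (\<lambda>_. \<one>)"
    by (simp only: one_classes_group singleton_iff)
  then show "a \<in> unit_on_classes Y S (topspace Y)"
    by (simp only: unit_on_classesI maps_null_on_one)
qed

lemma unit_on_classes_empty: "unit_on_classes Y S {} = carrier (classes_group Y S)"
  by (simp add: unit_on_classes_def carrier_classes_group)

lemma unit_on_classes_normal: "unit_on_classes Y S A \<lhd> classes_group Y S"
proof -
  let ?H = "classes_group Y S"
  interpret H: group ?H
    by (rule group_classes_group)
  show ?thesis
  proof (rule H.normal_invI)
    show "subgroup (unit_on_classes Y S A) ?H"
    proof (rule H.subgroupI)
      show "unit_on_classes Y S A \<subseteq> carrier ?H"
        by (auto simp: unit_on_classes_def carrier_classes_group)
      show "unit_on_classes Y S A \<noteq> {}"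
        using unit_on_classesI[OF maps_null_on_one, of Y A S] by blast
    next
      fix a assume "a \<in> unit_on_classes Y S A"
      then obtain f where f: "f \<in> maps_null_on Y S" "a = homotopy_class Y f"
        "\<And>y. y \<in> topspace Y \<Longrightarrow> y \<in> A \<Longrightarrow> f y = \<one>"
        by (rule unit_on_classesE) blast
      show "inv\<^bsub>?H\<^esub> a \<in> unit_on_classes Y S A"
        unfolding f(2) inv_classes_group[OF f(1)]
        by (rule unit_on_classesI) (simp_all add: maps_null_on_inv f)
    next
      fix a b assume "a \<in> unit_on_classes Y S A" "b \<in> unit_on_classes Y S A"
      then obtain f g where f: "f \<in> maps_null_on Y S" "a = homotopy_class Y f"
          "continuous_map Y T f" "\<And>y. y \<in> topspace Y \<Longrightarrow> y \<in> A \<Longrightarrow> f y = \<one>"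
        and g: "g \<in> maps_null_on Y S" "b = homotopy_class Y g"
          "continuous_map Y T g" "\<And>y. y \<in> topspace Y \<Longrightarrow> y \<in> A \<Longrightarrow> g y = \<one>"
        by (metis unit_on_classesE)
      show "a \<otimes>\<^bsub>?H\<^esub> b \<in> unit_on_classes Y S A"
        unfolding f(2) g(2) mult_classes_group[OF f(3) g(3)]
        by (rule unit_on_classesI) (simp_all add: maps_null_on_mult f g)
    qed
  next
    fix a b assume "a \<in> carrier ?H" and b: "b \<in> unit_on_classes Y S A"
    then have a: "a \<in> unit_on_classes Y S {}"
      by (simp add: unit_on_classes_empty)
    obtain f where f: "f \<in> maps_null_on Y S" "a = homotopy_class Y f"
        "continuous_map Y T f" "\<And>y. y \<in> topspace Y \<Longrightarrow> f y \<in> carrier G"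
      using a by (rule unit_on_classesE) blast
    obtain g where g: "g \<in> maps_null_on Y S" "b = homotopy_class Y g"
        "continuous_map Y T g" "\<And>y. y \<in> topspace Y \<Longrightarrow> g y \<in> carrier G"
        "\<And>y. y \<in> topspace Y \<Longrightarrow> y \<in> A \<Longrightarrow> g y = \<one>"
      using b by (rule unit_on_classesE) blast
    have "a \<otimes>\<^bsub>?H\<^esub> b \<otimes>\<^bsub>?H\<^esub> inv\<^bsub>?H\<^esub> a = homotopy_class Y (\<lambda>y. f y \<otimes> g y \<otimes> inv (f y))"
      by (simp add: f(2) g(2) inv_classes_group[OF f(1)] mult_classes_group f(3) g(3)
          continuous_map_mult continuous_map_inv)
    also have "\<dots> \<in> unit_on_classes Y S A"
      by (rule unit_on_classesI)
        (simp_all add: maps_null_on_mult maps_null_on_inv f(1,4) g(1,5))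
    finally show "a \<otimes>\<^bsub>?H\<^esub> b \<otimes>\<^bsub>?H\<^esub> inv\<^bsub>?H\<^esub> a \<in> unit_on_classes Y S A" .
  qed
qed

text \<open>
  The commutator of two group elements is trivial as soon as one of them is the unit, so the sets on
  which the representatives are trivial add up.
\<close>

lemma commutator_unit_on_classes:
  assumes a: "a \<in> unit_on_classes Y S A" and b: "b \<in> unit_on_classes Y S B"
  defines "H \<equiv> classes_group Y S"
  shows "a \<otimes>\<^bsub>H\<^esub> b \<otimes>\<^bsub>H\<^esub> inv\<^bsub>H\<^esub> a \<otimes>\<^bsub>H\<^esub> inv\<^bsub>H\<^esub> b \<in> unit_on_classes Y S (A \<union> B)"
proof -
  obtain f where f: "f \<in> maps_null_on Y S" "a = homotopy_class Y f"
      "continuous_map Y T f" "\<And>y. y \<in> topspace Y \<Longrightarrow> f y \<in> carrier G"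
      "\<And>y. y \<in> topspace Y \<Longrightarrow> y \<in> A \<Longrightarrow> f y = \<one>"
    using a by (rule unit_on_classesE) blast
  obtain g where g: "g \<in> maps_null_on Y S" "b = homotopy_class Y g"
      "continuous_map Y T g" "\<And>y. y \<in> topspace Y \<Longrightarrow> g y \<in> carrier G"
      "\<And>y. y \<in> topspace Y \<Longrightarrow> y \<in> B \<Longrightarrow> g y = \<one>"
    using b by (rule unit_on_classesE) blast
  have "a \<otimes>\<^bsub>H\<^esub> b \<otimes>\<^bsub>H\<^esub> inv\<^bsub>H\<^esub> a \<otimes>\<^bsub>H\<^esub> inv\<^bsub>H\<^esub> b
      = homotopy_class Y (\<lambda>y. f y \<otimes> g y \<otimes> inv (f y) \<otimes> inv (g y))"
    by (simp add: H_def f(2) g(2) inv_classes_group[OF f(1)] inv_classes_group[OF g(1)]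
        mult_classes_group f(3) g(3) continuous_map_mult continuous_map_inv)
  also have "\<dots> \<in> unit_on_classes Y S (A \<union> B)"
  proof (rule unit_on_classesI)
    show "(\<lambda>y. f y \<otimes> g y \<otimes> inv (f y) \<otimes> inv (g y)) \<in> maps_null_on Y S"
      using f(1) g(1) by (simp add: maps_null_on_mult maps_null_on_inv)
    show "f y \<otimes> g y \<otimes> inv (f y) \<otimes> inv (g y) = \<one>" if "y \<in> topspace Y" "y \<in> A \<union> B" for y
      using that(2) f(4,5)[OF that(1)] g(4,5)[OF that(1)] by auto
  qed
  finally show ?thesis .
qed

text \<open>
  The null-homotopy exists only over \<open>U\<close>. Running it at \<open>y\<close> only up to time \<open>\<phi> y\<close>, where \<open>\<phi>\<close> is
  \<open>1\<close> on \<open>A\<close> and vanishes near the complement of \<open>U\<close>, lets it be continued by the constant homotopy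
  to all of \<open>Y\<close> without a homotopy extension property.
\<close>

lemma homotopic_to_unit_on_closed:
  fixes Y :: "'y topology"
  assumes normal: "normal_space Y" and f: "continuous_map Y T f"
    and U: "openin Y U" and A: "closedin Y A" "A \<subseteq> U"
    and null: "homotopic (subtopology Y U) f (\<lambda>_. \<one>)"
  obtains g where "homotopic Y f g" "\<forall>y\<in>A. g y = \<one>"
proof -
  let ?I = "top_of_set {0..1::real}"
  obtain V where V: "openin Y V" "A \<subseteq> V" "Y closure_of V \<subseteq> U"
    using normal A U unfolding normal_space_alt by meson
  have Usub: "U \<subseteq> topspace Y"
    using U by (rule openin_subset)
  obtain \<phi> where \<phi>: "continuous_map Y ?I \<phi>" "\<phi> ` (topspace Y - V) \<subseteq> {0}" "\<phi> ` A \<subseteq> {1}"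
  proof (rule Urysohn_lemma[of Y "topspace Y - V" A 0 1])
    show "disjnt (topspace Y - V) A"
      using V by (auto simp: disjnt_def)
  qed (use normal A V in auto)
  obtain h where h: "continuous_map (prod_topology ?I (subtopology Y U)) T h"
    "\<And>y. h (0, y) = f y" "\<And>y. h (1, y) = \<one>"
    using null unfolding homotopic_with_def by metis
  \<comment> \<open>The two open sets on which the homotopy is pasted together; on their overlap \<open>\<phi>\<close> is \<open>0\<close>.\<close>
  define W where "W = (\<lambda>b. if b then U else topspace Y - Y closure_of V)"
  define F where "F = (\<lambda>b. if b then (\<lambda>(s, y). h (s * \<phi> y, y)) else (\<lambda>(s, y). f y))"
  define k where "k = (\<lambda>(s::real, y). if y \<in> U then h (s * \<phi> y, y) else f y)"
  have \<phi>01: "\<phi> y \<in> {0..1}" if "y \<in> topspace Y" for y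
    using continuous_map_funspace[OF \<phi>(1)] that by auto
  have k: "continuous_map (prod_topology ?I Y) T k"
  proof (rule pasting_lemma[where I = UNIV and T = "\<lambda>b. {0..1} \<times> W b" and f = F])
    fix b :: bool
    have "openin ?I {0..1}"
      using openin_topspace[of ?I] by simp
    then show "openin (prod_topology ?I Y) ({0..1} \<times> W b)"
      using U by (auto simp: openin_prod_Times_iff W_def)
    show "continuous_map (subtopology (prod_topology ?I Y) ({0..1} \<times> W b)) T (F b)"
    proof (cases b)
      case True
      let ?Z = "prod_topology ?I (subtopology Y U)"
      have eq: "subtopology (prod_topology ?I Y) ({0..1} \<times> U) = ?Z"
        by (simp add: subtopology_Times subtopology_subtopology)
      have \<phi>_snd: "continuous_map ?Z ?I (\<lambda>z. \<phi> (snd z))"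
        using continuous_map_compose[OF continuous_map_snd continuous_map_from_subtopology[OF \<phi>(1)]]
        by (simp add: o_def)
      have "continuous_map ?Z euclideanreal (\<lambda>z. fst z * \<phi> (snd z))"
        using \<phi>_snd continuous_map_fst[of ?I "subtopology Y U"]
        by (intro continuous_map_real_mult) (auto simp: continuous_map_in_subtopology)
      moreover have "fst z * \<phi> (snd z) \<in> {0..1}" if "z \<in> topspace ?Z" for z
        using that \<phi>01[of "snd z"] by (auto intro: mult_le_one)
      ultimately have "continuous_map ?Z ?I (\<lambda>z. fst z * \<phi> (snd z))"
        by (auto simp: continuous_map_in_subtopology)
      then have "continuous_map ?Z ?Z (\<lambda>z. (fst z * \<phi> (snd z), snd z))"
        by (intro continuous_map_pairedI continuous_map_snd)
      from continuous_map_compose[OF this h(1)] True show ?thesis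
        by (simp add: W_def F_def eq o_def case_prod_beta')
    next
      case False
      have "continuous_map (prod_topology ?I Y) T (\<lambda>z. f (snd z))"
        using continuous_map_compose[OF continuous_map_snd f] by (simp add: o_def)
      then show ?thesis
        using False by (simp add: F_def case_prod_beta' continuous_map_from_subtopology)
    qed
  next
    fix b c and z :: "real \<times> 'y"
    assume z: "z \<in> topspace (prod_topology ?I Y) \<inter> {0..1} \<times> W b \<inter> {0..1} \<times> W c"
    have "F b z = F c z" if "b \<noteq> c"
    proof -
      have y: "snd z \<in> topspace Y" "snd z \<notin> Y closure_of V"
        using z that by (auto simp: W_def split: if_splits)
      then have "snd z \<notin> V"
        using closure_of_subset[OF openin_subset[OF V(1)]] by auto
      then have "\<phi> (snd z) = 0"
        using \<phi>(2) y by auto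
      then show ?thesis
        using that by (auto simp: F_def h(2) case_prod_beta')
    qed
    then show "F b z = F c z"
      by (cases "b = c") blast+
  next
    fix z :: "real \<times> 'y"
    assume "z \<in> topspace (prod_topology ?I Y)"
    then show "\<exists>b. b \<in> UNIV \<and> z \<in> {0..1} \<times> W b \<and> k z = F b z"
      using V(3) by (intro exI[of _ "snd z \<in> U"]) (auto simp: W_def F_def k_def)
  qed
  have "homotopic Y f (\<lambda>y. k (1, y))"
    unfolding homotopic_with_def
    by (rule exI[of _ k]) (use k h(2) in \<open>auto simp: k_def\<close>)
  moreover have "\<forall>y\<in>A. k (1, y) = \<one>"
    using A \<phi>(3) by (auto simp: k_def h(3) image_subset_iff)
  ultimately show ?thesis ..
qed

lemma unit_on_classes_eq_carrier:
  assumes "normal_space Y" "openin Y U" "closedin Y A" "A \<subseteq> U"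
    and "\<And>f. f \<in> maps_null_on Y S \<Longrightarrow> null_homotopic_on Y T U f"
  shows "unit_on_classes Y S A = carrier (classes_group Y S)"
proof
  show "unit_on_classes Y S A \<subseteq> carrier (classes_group Y S)"
    by (auto simp: unit_on_classes_def carrier_classes_group)
  show "carrier (classes_group Y S) \<subseteq> unit_on_classes Y S A"
  proof
    fix a assume "a \<in> carrier (classes_group Y S)"
    then obtain f where f: "f \<in> maps_null_on Y S" "a = homotopy_class Y f"
      by (auto simp: carrier_classes_group)
    obtain g where g: "homotopic Y f g" "\<forall>y\<in>A. g y = \<one>"
      using homotopic_to_unit_on_closed[OF assms(1) maps_null_on_continuous[OF f(1)] assms(2-4)]
        assms(5)[OF f(1)] by (metis null_homotopic_on_iff)
    have "g \<in> maps_null_on Y S"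
      using f g maps_null_on_homotopic by blast
    moreover from this have "a = homotopy_class Y g"
      using f g by (simp add: homotopy_class_eq_iff maps_null_on_continuous)
    ultimately show "a \<in> unit_on_classes Y S A"
      using g by (auto simp: unit_on_classes_def)
  qed
qed

end


section \<open>The central series of a categorical cover\<close>

text \<open>
  The members of the cover are shrunk one at a time; \<open>W\<close> collects those not yet treated. The new sets
  are kept open, because what they and \<open>W\<close> leave uncovered has to be closed in the next step.
\<close>

lemma normal_space_shrink_open_cover:
  assumes "normal_space Y" "finite I" "\<And>i. i \<in> I \<Longrightarrow> openin Y (U i)" "openin Y W"
    and "(\<Union>i\<in>I. U i) \<union> W = topspace Y"
  shows "\<exists>V. (\<forall>i\<in>I. openin Y (V i) \<and> Y closure_of V i \<subseteq> U i) \<and> (\<Union>i\<in>I. V i) \<union> W = topspace Y"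
  using assms(2-)
proof (induction I arbitrary: W rule: finite_induct)
  case empty
  then show ?case by simp
next
  case (insert j I)
  have "\<exists>V. (\<forall>i\<in>I. openin Y (V i) \<and> Y closure_of V i \<subseteq> U i) \<and>
      (\<Union>i\<in>I. V i) \<union> (U j \<union> W) = topspace Y"
  proof (rule insert.IH)
    show "openin Y (U j \<union> W)"
      using insert.prems(1)[of j] insert.prems(2) by (simp add: openin_Un)
    show "(\<Union>i\<in>I. U i) \<union> (U j \<union> W) = topspace Y"
      using insert.prems(3) by (simp add: Un_ac)
  qed (use insert.prems(1) in simp)
  then obtain V
    where V: "\<forall>i\<in>I. openin Y (V i) \<and> Y closure_of V i \<subseteq> U i"
      "(\<Union>i\<in>I. V i) \<union> (U j \<union> W) = topspace Y"
    by (elim exE conjE)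
  let ?C = "topspace Y - ((\<Union>i\<in>I. V i) \<union> W)"
  have "openin Y ((\<Union>i\<in>I. V i) \<union> W)"
    using V(1) insert.prems(2) by (intro openin_Un openin_Union) auto
  then have "closedin Y ?C"
    by (rule closedin_diff[OF closedin_topspace])
  moreover have "?C \<subseteq> U j"
    using V(2) by blast
  moreover have "openin Y (U j)"
    using insert.prems by simp
  ultimately obtain Vj where Vj: "openin Y Vj" "?C \<subseteq> Vj" "Y closure_of Vj \<subseteq> U j"
    using assms(1) unfolding normal_space_alt by meson
  let ?V = "V(j := Vj)"
  have sub: "\<forall>i\<in>insert j I. openin Y (?V i) \<and> Y closure_of ?V i \<subseteq> U i"
    using V(1) Vj by simp
  have "(\<Union>i\<in>I. ?V i) = (\<Union>i\<in>I. V i)"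
    using insert.hyps by (intro SUP_cong) auto
  then have "(\<Union>i\<in>insert j I. ?V i) \<union> W = Vj \<union> ((\<Union>i\<in>I. V i) \<union> W)"
    by (simp only: UN_insert fun_upd_same Un_assoc)
  also have "\<dots> = topspace Y"
  proof
    show "Vj \<union> ((\<Union>i\<in>I. V i) \<union> W) \<subseteq> topspace Y"
      using openin_subset[OF Vj(1)] V(2) by blast
    show "topspace Y \<subseteq> Vj \<union> ((\<Union>i\<in>I. V i) \<union> W)"
      using Vj(2) by (simp only: Diff_subset_conv Un_commute)
  qed
  finally show ?case
    by (intro exI[of _ ?V] conjI sub)
qed

corollary normal_space_closed_shrinking:
  assumes "normal_space Y" "finite I" "\<And>i. i \<in> I \<Longrightarrow> openin Y (U i)" "(\<Union>i\<in>I. U i) = topspace Y"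
  obtains A where "\<And>i. i \<in> I \<Longrightarrow> closedin Y (A i)" "\<And>i. i \<in> I \<Longrightarrow> A i \<subseteq> U i"
    "(\<Union>i\<in>I. A i) = topspace Y"
proof -
  have "\<exists>V. (\<forall>i\<in>I. openin Y (V i) \<and> Y closure_of V i \<subseteq> U i) \<and> (\<Union>i\<in>I. V i) \<union> {} = topspace Y"
    by (rule normal_space_shrink_open_cover) (use assms in simp_all)
  then obtain V where V: "\<forall>i\<in>I. openin Y (V i) \<and> Y closure_of V i \<subseteq> U i"
    "(\<Union>i\<in>I. V i) \<union> {} = topspace Y"
    by (elim exE conjE)
  have "V i \<subseteq> Y closure_of V i" if "i \<in> I" for i
    using V that by (simp add: closure_of_subset openin_subset)
  then have "(\<Union>i\<in>I. V i) \<subseteq> (\<Union>i\<in>I. Y closure_of V i)"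
    by (intro UN_mono order_refl)
  with V(2) have "(\<Union>i\<in>I. Y closure_of V i) = topspace Y"
    by (intro equalityI UN_least closure_of_subset_topspace) simp_all
  with V(1) show ?thesis
    by (intro that[of "\<lambda>i. Y closure_of V i"]) simp_all
qed

text \<open>
  The terms \<open>\<Gamma> i\<close> are given by triviality on the first \<open>i\<close> closed sets; multiplication by commutators
  adds the next one, on which any class can be made trivial.
\<close>

theorem (in path_connected_topological_group) central_series_of_categorical_cover:
  assumes normal: "normal_space Y" and U: "\<And>i. i \<le> n \<Longrightarrow> openin Y (U i)"
    and cover: "(\<Union>i\<le>n. U i) = topspace Y"
    and null: "\<And>i f. i \<le> n \<Longrightarrow> f \<in> maps_null_on Y S \<Longrightarrow> null_homotopic_on Y T (U i) f"
  shows "\<exists>\<Gamma>. central_series (classes_group Y S) n \<Gamma>"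
proof -
  let ?H = "classes_group Y S"
  interpret H: group ?H
    by (rule group_classes_group)
  obtain A where A: "\<And>i. i \<le> n \<Longrightarrow> closedin Y (A i)" "\<And>i. i \<le> n \<Longrightarrow> A i \<subseteq> U i"
    "(\<Union>i\<le>n. A i) = topspace Y"
    by (rule normal_space_closed_shrinking[of Y "{..n}" U]) (simp_all add: normal U cover, blast)
  define \<Gamma> where "\<Gamma> i = unit_on_classes Y S (\<Union>j<i. A j)" for i
  have all: "unit_on_classes Y S (A i) = carrier ?H" if "i \<le> n" for i
    using normal U[OF that] A(1)[OF that] A(2)[OF that] null[OF that]
    by (rule unit_on_classes_eq_carrier)
  have "central_series ?H n \<Gamma>"
    unfolding central_series_def
  proof (intro conjI ballI)
    show "\<Gamma> 1 = carrier ?H"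
      using all[of 0] by (simp add: \<Gamma>_def lessThan_Suc)
    show "\<Gamma> (n + 1) = {\<one>\<^bsub>?H\<^esub>}"
      using unit_on_classes_topspace by (simp add: \<Gamma>_def lessThan_Suc_atMost A(3))
  next
    fix i
    have "\<Gamma> (i + 1) \<subseteq> \<Gamma> i"
      unfolding \<Gamma>_def by (intro unit_on_classes_mono UN_mono) auto
    then show "\<Gamma> (i + 1) \<lhd> ?H\<lparr>carrier := \<Gamma> i\<rparr>"
      unfolding \<Gamma>_def
      by (intro H.normal_restrict_supergroup normal_imp_subgroup unit_on_classes_normal)
  next
    fix i h k assume i: "i \<in> {1..n}" and h: "h \<in> carrier ?H" and k: "k \<in> \<Gamma> i"
    have "h \<in> unit_on_classes Y S (A i)"
      using h i all by simp
    moreover have "(\<Union>j<i + 1. A j) = A i \<union> (\<Union>j<i. A j)"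
      by (auto simp: less_Suc_eq)
    ultimately show "h \<otimes>\<^bsub>?H\<^esub> k \<otimes>\<^bsub>?H\<^esub> inv\<^bsub>?H\<^esub> h \<otimes>\<^bsub>?H\<^esub> inv\<^bsub>?H\<^esub> k \<in> \<Gamma> (i + 1)"
      using commutator_unit_on_classes k unfolding \<Gamma>_def by metis
  qed
  then show ?thesis
    by (rule exI[of _ \<Gamma>])
qed


section \<open>Partial sections of the path fibration\<close>

text \<open>
  One half of the exponential law for the compact-open topology, which holds because the interval
  is locally compact: the path \<open>s z\<close> maps a compact neighbourhood of \<open>r\<close> into a given neighbourhood
  of \<open>s z r\<close>, and then so does \<open>s z'\<close> for all \<open>z'\<close> near \<open>z\<close>.
\<close>

lemma continuous_map_path_uncurry:
  assumes s: "continuous_map Z (path_topology X) s"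
  shows "continuous_map (prod_topology (top_of_set {0..1}) Z) X (\<lambda>(r, z). s z r)"
  unfolding continuous_map_eq_topcontinuous_at
proof
  let ?I = "top_of_set {0..1::real}"
  have path: "continuous_map ?I X (s z)" if "z \<in> topspace Z" for z
    using continuous_map_funspace[OF s] that
    by (auto simp: path_topology_def mapping_space_def)
  fix p assume "p \<in> topspace (prod_topology ?I Z)"
  then obtain r z where p: "p = (r, z)" "r \<in> {0..1}" "z \<in> topspace Z"
    by auto
  have "\<exists>N. openin (prod_topology ?I Z) N \<and> p \<in> N \<and> (\<forall>q\<in>N. (\<lambda>(r, z). s z r) q \<in> V)"
    if V: "openin X V" "s z r \<in> V" for V
  proof -
    have "openin ?I {u \<in> topspace ?I. s z u \<in> V}"
      using path[OF p(3)] V(1) by (rule openin_continuous_map_preimage)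
    then obtain e where e: "e > 0" "cball r e \<inter> {0..1} \<subseteq> {u \<in> topspace ?I. s z u \<in> V}"
      unfolding openin_contains_cball using p V by auto
    let ?K = "cball r e \<inter> {0..1}"
    let ?B = "{f \<in> mapping_space ?I X. f ` ?K \<subseteq> V}"
    have "compactin ?I ?K"
      by (simp add: compactin_subtopology compact_Int_closed)
    then have "openin (path_topology X) ?B"
      unfolding path_topology_def compact_open_topology_def
      using V(1) by (intro topology_generated_by_Basis) blast
    then have "openin Z {z \<in> topspace Z. s z \<in> ?B}"
      by (rule openin_continuous_map_preimage[OF s])
    moreover have "openin ?I ({0..1} \<inter> ball r e)"
      by (simp add: openin_open_Int)
    ultimately have "openin (prod_topology ?I Z)
        (({0..1} \<inter> ball r e) \<times> {z \<in> topspace Z. s z \<in> ?B})"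
      by (simp add: openin_prod_Times_iff)
    moreover have "s z \<in> ?B"
      using e(2) continuous_map_funspace[OF s] p(3) by (auto simp: path_topology_def)
    ultimately show ?thesis
      using p e(1)
      by (intro exI[of _ "({0..1} \<inter> ball r e) \<times> {z \<in> topspace Z. s z \<in> ?B}"])
        (auto simp: image_subset_iff)
  qed
  moreover have "(\<lambda>(r, z). s z r) \<in> topspace (prod_topology ?I Z) \<rightarrow> topspace X"
    using continuous_map_funspace[OF path] by fastforce
  ultimately show "topcontinuous_at (prod_topology ?I Z) X (\<lambda>(r, z). s z r) p"
    using p by (auto simp: topcontinuous_at_def)
qed

lemma evaluation_times_unit_interval:
  assumes "evaluation_times m t" "j < m"
  shows "t j \<in> {0..1}"
proof -
  have mono: "t i \<le> t k" if "i \<le> k" "k < m" for i k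
    using assms(1) that strict_mono_on_leD[of "{..<m}" t i k]
    by (auto simp: evaluation_times_def)
  show ?thesis
    using mono[of 0 j] mono[of j "m - 1"] assms by (auto simp: evaluation_times_def)
qed

text \<open>
  A point \<open>x\<close> over which the section is defined is the tuple of values of the path \<open>s x\<close> at the times
  \<open>t j\<close>. Scaling all these times by \<open>1 - u\<close> ends, at \<open>u = 1\<close>, in the tuple with all entries \<open>s x 0\<close>.
\<close>

lemma section_deforms_into_diagonal:
  assumes t: "evaluation_times m t" and U: "openin (power_topology m X) U"
    and sec: "has_section_over m t X U"
  obtains r where "homotopic_with (\<lambda>_. True) (subtopology (power_topology m X) U) (power_topology m X) id r"
    "r \<in> U \<rightarrow> diagonal m X"
proof -
  let ?I = "top_of_set {0..1::real}" and ?P = "power_topology m X"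
  let ?Z = "subtopology ?P U"
  obtain s where s: "continuous_map ?Z (path_topology X) s"
    and sec: "\<And>x. x \<in> U \<Longrightarrow> path_eval m t (s x) = x"
    using sec unfolding has_section_over_def by blast
  have U_top: "topspace ?Z = U"
    using openin_subset[OF U] by auto
  define h where "h = (\<lambda>(u::real, x). \<lambda>j\<in>{..<m}. s x ((1 - u) * t j))"
  have comp: "continuous_map (prod_topology ?I ?Z) X (\<lambda>z. s (snd z) ((1 - fst z) * t j))"
    if "j < m" for j
  proof -
    have "continuous_map (prod_topology ?I ?Z) euclideanreal (\<lambda>z. (1 - fst z) * t j)"
      using continuous_map_fst[of ?I ?Z]
      by (intro continuous_map_real_mult continuous_map_diff) (auto simp: continuous_map_in_subtopology)
    moreover have "(1 - fst z) * t j \<in> {0..1}" if "z \<in> topspace (prod_topology ?I ?Z)" for z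
      using that evaluation_times_unit_interval[OF t \<open>j < m\<close>] by (auto intro: mult_le_one)
    ultimately have "continuous_map (prod_topology ?I ?Z) ?I (\<lambda>z. (1 - fst z) * t j)"
      by (auto simp: continuous_map_in_subtopology)
    then have "continuous_map (prod_topology ?I ?Z) (prod_topology ?I ?Z)
        (\<lambda>z. ((1 - fst z) * t j, snd z))"
      by (intro continuous_map_pairedI continuous_map_snd)
    from continuous_map_compose[OF this continuous_map_path_uncurry[OF s]] show ?thesis
      by (simp add: o_def)
  qed
  have h: "continuous_map (prod_topology ?I ?Z) ?P h"
    unfolding power_topology_def continuous_map_componentwise
    using comp by (auto simp: h_def power_topology_def case_prod_beta')
  show ?thesis
  proof
    show "homotopic_with (\<lambda>_. True) ?Z ?P id (\<lambda>x. h (1, x))"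
    proof (subst homotopic_with)
      have "h (0, x) = x" if "x \<in> U" for x
        using sec[OF that] by (simp add: h_def path_eval_def)
      then show "\<exists>k. continuous_map (prod_topology ?I ?Z) ?P k \<and>
          (\<forall>x\<in>topspace ?Z. k (0, x) = id x) \<and> (\<forall>x\<in>topspace ?Z. k (1, x) = h (1, x)) \<and>
          (\<forall>u\<in>{0..1}. True)"
        using h U_top by (intro exI[of _ h]) auto
    qed simp
    show "(\<lambda>x. h (1, x)) \<in> U \<rightarrow> diagonal m X"
    proof
      fix x assume x: "x \<in> U"
      have "s x \<in> mapping_space ?I X"
        using continuous_map_funspace[OF s] x U_top by (auto simp: path_topology_def)
      then have "s x 0 \<in> topspace X"
        using continuous_map_funspace[of ?I X "s x"] by (auto simp: mapping_space_def)
      then show "h (1, x) \<in> diagonal m X"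
        by (simp add: h_def diagonal_def)
    qed
  qed
qed

lemma (in path_connected_topological_group) null_homotopic_on_section_domain:
  assumes t: "evaluation_times m t" and U: "openin (power_topology m X) U"
    and sec: "has_section_over m t X U"
    and f: "f \<in> maps_null_on (power_topology m X) (diagonal m X)"
  shows "null_homotopic_on (power_topology m X) T U f"
proof -
  let ?P = "power_topology m X" and ?D = "diagonal m X"
  let ?Z = "subtopology ?P U"
  obtain r where r: "homotopic_with (\<lambda>_. True) ?Z ?P id r" "r \<in> U \<rightarrow> ?D"
    using section_deforms_into_diagonal[OF t U sec] .
  have "homotopic ?Z (f \<circ> id) (f \<circ> r)"
    using r(1) maps_null_on_continuous[OF f]
    by (rule homotopic_with_compose_continuous_map_left) simp
  moreover have "continuous_map ?Z (subtopology ?P ?D) r"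
    using homotopic_with_imp_continuous_maps[OF r(1)] r(2)
    by (auto simp: continuous_map_in_subtopology)
  then have "homotopic ?Z (f \<circ> r) ((\<lambda>_. \<one>) \<circ> r)"
    using f by (intro homotopic_with_compose_continuous_map_right[of "\<lambda>_. True" "subtopology ?P ?D"])
      (auto simp: maps_null_on_def null_homotopic_on_iff)
  ultimately have "homotopic ?Z (f \<circ> id) ((\<lambda>_. \<one>) \<circ> r)"
    by (rule homotopic_with_trans)
  then show ?thesis
    by (simp add: null_homotopic_on_iff o_def)
qed


section \<open>Nilpotency and sequential topological complexity\<close>

lemma normal_space_power_topology:
  assumes "metrizable_space X"
  shows "normal_space (power_topology m X)"
  unfolding power_topology_def
  by (rule metrizable_imp_normal_space)
    (use assms in \<open>auto simp: metrizable_space_product_topology intro: countable_subset[of _ "{..<m}"]\<close>)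

theorem theorem1p4:
  fixes m :: nat and t :: "nat \<Rightarrow> real"
    and G :: "('g, 'r) monoid_scheme" and T :: "'g topology"
    and X :: "'a topology"
  assumes "m \<ge> 2" and "evaluation_times m t"
    and "topological_group G T" and "path_connected_space T"
    and "ANR_space X"
  shows "let H = null_on_classes_group (power_topology m X) (diagonal m X) G T in
           group H \<and>
           (sequential_TC m t X < \<infinity> \<longrightarrow> nilpotent_group H) \<and>
           nilpotency_class H \<le> sequential_TC m t X"
proof -
  interpret topological_group_space G T
    using assms(3) by (simp add: topological_group_space_iff)
  interpret path_connected_topological_group G T
    by unfold_locales (rule assms(4))
  let ?P = "power_topology m X" and ?D = "diagonal m X"
  let ?H = "classes_group ?P ?D"
  define N where "N = {n. \<exists>U :: nat \<Rightarrow> (nat \<Rightarrow> 'a) set.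
      (\<forall>i\<le>n. openin ?P (U i) \<and> has_section_over m t X (U i)) \<and> (\<Union>i\<le>n. U i) = topspace ?P}"
  have TC: "sequential_TC m t X = Inf (enat ` N)"
    unfolding sequential_TC_def N_def by (rule arg_cong[of _ _ Inf]) auto
  have normal: "normal_space ?P"
    using assms(5) by (auto simp: ANR_space_def intro: normal_space_power_topology)
  have series: "\<exists>\<Gamma>. central_series ?H n \<Gamma>" if n: "n \<in> N" for n
  proof -
    obtain U :: "nat \<Rightarrow> (nat \<Rightarrow> 'a) set"
      where U: "\<And>i. i \<le> n \<Longrightarrow> openin ?P (U i)" "\<And>i. i \<le> n \<Longrightarrow> has_section_over m t X (U i)"
        "(\<Union>i\<le>n. U i) = topspace ?P"
      using n unfolding N_def by blast
    show ?thesis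
      using normal U(1,3)
      by (rule central_series_of_categorical_cover)
        (assumption, rule null_homotopic_on_section_domain[OF assms(2) U(1) U(2)])
  qed
  have "nilpotency_class ?H \<le> sequential_TC m t X"
    unfolding nilpotency_class_def TC using series by (intro Inf_superset_mono) auto
  moreover have "nilpotent_group ?H" if "sequential_TC m t X < \<infinity>"
  proof -
    have "N \<noteq> {}"
      using that by (auto simp: TC top_enat_def)
    then obtain n where "n \<in> N"
      by blast
    then have "\<exists>\<Gamma>. central_series ?H n \<Gamma>"
      by (rule series)
    then show ?thesis
      unfolding nilpotent_group_def by (intro conjI group_classes_group exI[of _ n])
  qed
  ultimately show ?thesis
    using group_classes_group by (simp add: Let_def)
qed

end
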